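(* Let $ABC$ be a triangle with circumcircle $\Gamma$ and let $T$ be a point not on the lines $BC, CA, AB$. Let $\Omega$ be an arbitrary circle through $T$. Let the perpendiculars from $T$ to $BC$, $CA$, $AB$ meet $\Omega$ again at $X$, $Y$, $Z$ respectively. Let $\sigma$ be the indirect (orientation-reversing) similarity of the plane with $\sigma(A)=X$, $\sigma(B)=Y$, $\sigma(C)=Z$, and let $P$ be its centre, i.e. its unique fixed point. Assume $P\notin\Gamma$. Let the lines $AP, BP, CP$ meet $\Gamma$ again at $D, E, F$ respectively, and let $U=\sigma(D)$, $V=\sigma(E)$, $W=\sigma(F)$. Then $X,P,U$ are collinear, $Y,P,V$ are collinear, and $Z,P,W$ are collinear; that is, triangles $XYZ$ and $UVW$ are in perspective with centre $P$, and, since these six points all lie on $\Omega$, the pairs $(X,U)$, $(Y,V)$, $(Z,W)$ are pairs of an involution on $\Omega$ given by projection through $P$.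
   Context: All objects lie in the Euclidean plane. If a perpendicular is tangent to $\Omega$ at $T$, its second intersection with $\Omega$ is taken to be $T$; likewise, if $AP$ is tangent to $\Gamma$ at $A$ then $D=A$, and similarly for $E,F$. In this configuration triangle $XYZ$ is indirectly similar to triangle $ABC$ (with vertices corresponding in the order $A\to X$, $B\to Y$, $C\to Z$), so the similarity $\sigma$ exists and is unique; it maps $\Gamma$ to $\Omega$, so $U,V,W$ lie on $\Omega$. It is assumed that $\sigma$ has a unique fixed point (equivalently, that its ratio is not $1$). The involution on $\Omega$ given by projection through a point $P\notin\Omega$ sends $S\in\Omega$ to the second intersection of line $SP$ with $\Omega$ (and to $S$ itself if $SP$ is tangent to $\Omega$). *)

theory Defs
  imports "HOL-Analysis.Analysis"
begin

text \<open>The Euclidean plane is the type \<^typ>\<open>complex\<close>, with its Euclidean distance and inner product.\<close>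

definition perpendicular_line :: "complex \<Rightarrow> complex \<Rightarrow> complex \<Rightarrow> complex set" where
  "perpendicular_line Q B C = {S. (S - Q) \<bullet> (C - B) = 0}"

text \<open>For a circle \<open>K\<close> and a line \<open>l\<close> through a point \<open>S\<close> of \<open>K\<close>: if \<open>l\<close> is tangent to \<open>K\<close>,
  then \<open>K \<inter> l = {S}\<close> and the value is \<open>S\<close> itself; otherwise the value is the other common point.\<close>

definition second_intersection :: "complex set \<Rightarrow> complex set \<Rightarrow> complex \<Rightarrow> complex" where
  "second_intersection K l S = (THE S'. K \<inter> l = {S, S'})"

definition similarity :: "(complex \<Rightarrow> complex) \<Rightarrow> bool" where
  "similarity f \<longleftrightarrow> (\<exists>k>0. \<forall>p q. dist (f p) (f q) = k * dist p q)"

text \<open>The imaginary part below is twice the signed area of the triangle \<open>p q r\<close>.\<close>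

definition orientation :: "complex \<Rightarrow> complex \<Rightarrow> complex \<Rightarrow> real" where
  "orientation p q r = sgn (Im (cnj (q - p) * (r - p)))"

definition indirect_similarity :: "(complex \<Rightarrow> complex) \<Rightarrow> bool" where
  "indirect_similarity f \<longleftrightarrow>
     similarity f \<and> (\<forall>p q r. orientation (f p) (f q) (f r) = - orientation p q r)"

definition in_perspective ::
  "complex \<Rightarrow> complex \<Rightarrow> complex \<Rightarrow> complex \<Rightarrow> complex \<Rightarrow> complex \<Rightarrow> complex \<Rightarrow> bool" where
  "in_perspective P X Y Z U V W \<longleftrightarrow>
     \<not> collinear {X, Y, Z} \<and> \<not> collinear {U, V, W} \<and>
     collinear {X, P, U} \<and> collinear {Y, P, V} \<and> collinear {Z, P, W}"

text \<open>Meaningful for \<open>P \<notin> K\<close> and \<open>S \<in> K\<close>, so that \<open>S \<noteq> P\<close> and the affine hull is a line.\<close>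

definition projection_through :: "complex \<Rightarrow> complex set \<Rightarrow> complex \<Rightarrow> complex" where
  "projection_through P K S = second_intersection K (affine hull {S, P}) S"

definition involution_on :: "'a set \<Rightarrow> ('a \<Rightarrow> 'a) \<Rightarrow> bool" where
  "involution_on K f \<longleftrightarrow> (\<forall>S\<in>K. f S \<in> K \<and> f (f S) = S)"

end

theory Submission
  imports Defs
begin

text \<open>
  The collinearities are formal once the map \<open>\<sigma>\<close> is under control: an indirect similarity that fixes
  \<open>P\<close> maps lines through \<open>P\<close> to lines through \<open>P\<close>, and it maps \<open>\<Gamma>\<close> onto \<open>\<Omega>\<close>. Hence it carries the
  two points \<open>{A, D}\<close> in which \<open>\<Gamma>\<close> meets the line \<open>AP\<close> to the two points in which \<open>\<Omega>\<close> meets the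
  line \<open>XP\<close>. So \<open>U\<close> is the projection of \<open>X\<close> through \<open>P\<close>
  (\<open>projection_through_reflective_affine\<close>), and projection of a circle through a point off it is
  an involution because both chord ends span the same line with \<open>P\<close>
  (\<open>involution_on_projection_through\<close>).

  The geometric content is that \<open>ABC\<close> and \<open>XYZ\<close> are indirectly similar. The chord of \<open>\<Omega>\<close> through
  \<open>T\<close> perpendicular to a direction \<open>a\<close> ends at the reflection of \<open>T\<close> in the diameter parallel to \<open>a\<close>,
  which is the point \<open>\<omega> + (a / cnj a) * cnj (T - \<omega>)\<close>
  (\<open>second_intersection_perpendicular_line\<close>). For consecutive sides \<open>a = C - B\<close>, \<open>b = A - C\<close>, the
  difference \<open>b / cnj b - a / cnj a\<close> is the signed area of the triangle times
  \<open>4 * \<i> / (cnj a * cnj b)\<close>, and likewise for the other pairs of consecutive sides. So the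
  differences of \<open>X\<close>, \<open>Y\<close>, \<open>Z\<close> are one common multiple of the conjugates of the corresponding
  differences of \<open>A\<close>, \<open>B\<close>, \<open>C\<close>. This yields a map \<open>z \<mapsto> n + m * cnj z\<close> taking
  \<open>A\<close>, \<open>B\<close>, \<open>C\<close> to \<open>X\<close>, \<open>Y\<close>, \<open>Z\<close>
  (\<open>perpendicular_chord_ends_reflective_affine\<close>), and a similarity is
  determined by its values at three points whose images are not collinear
  (\<open>similarity_determined_by_triangle\<close>). So the map is \<open>\<sigma>\<close>.

  Finally, both the uniqueness of \<open>\<sigma>\<close> and the fact that it sends the centre of \<open>\<Gamma>\<close> to the centre
  of \<open>\<Omega>\<close> are instances of one principle, \<open>eq_if_constant_power_difference\<close>.
\<close>

section \<open>Triangles in the complex plane\<close>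

lemma collinear_iff_area_zero:
  fixes p q r :: complex
  shows "collinear {p, q, r} \<longleftrightarrow> Im (cnj (q - p) * (r - p)) = 0"
proof -
  define d e where "d = q - p" and "e = r - p"
  have "\<exists>c. e = c *\<^sub>R d" if "Im (cnj d * e) = 0" "d \<noteq> 0"
  proof -
    define h where "h = Re (cnj d * e)"
    have "cnj d * e = of_real h"
      using that(1) by (simp add: h_def complex_eq_iff)
    then have "(d * cnj d) * e = of_real h * d" by (simp add: algebra_simps)
    then have "of_real ((norm d)\<^sup>2) * e = of_real h * d"
      by (simp only: complex_norm_square)
    then have "e = (h / (norm d)\<^sup>2) *\<^sub>R d"
      using that(2) by (simp add: scaleR_conv_of_real field_simps)
    then show ?thesis by blast
  qed
  moreover have "collinear {p, q, r} \<longleftrightarrow> collinear {0, d, e}"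
    using collinear_3[of q p r] by (simp add: d_def e_def insert_commute)
  ultimately show ?thesis
    unfolding d_def[symmetric] e_def[symmetric] by (auto simp: collinear_lemma)
qed

text \<open>Subtracting the hypotheses shows that \<open>p - q\<close> is orthogonal to two independent sides of the
  triangle. The lemma covers two classical facts: three noncollinear points are not all equidistant
  from two distinct points, and a triangle has only one circumcentre.\<close>

lemma eq_if_constant_power_difference:
  fixes X Y Z p q :: complex
  assumes "\<not> collinear {X, Y, Z}"
    and Y: "(dist p X)\<^sup>2 - (dist q X)\<^sup>2 = (dist p Y)\<^sup>2 - (dist q Y)\<^sup>2"
    and Z: "(dist p X)\<^sup>2 - (dist q X)\<^sup>2 = (dist p Z)\<^sup>2 - (dist q Z)\<^sup>2"
  shows "p = q"
proof -
  define a b c d where "a = Re (Y - X)" and "b = Im (Y - X)"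
    and "c = Re (Z - X)" and "d = Im (Z - X)"
  define u v where "u = Re (p - q)" and "v = Im (p - q)"
  have "u * a + v * b = 0" "u * c + v * d = 0"
    using Y Z unfolding a_def b_def c_def d_def u_def v_def dist_norm cmod_power2
    by (simp_all add: algebra_simps power2_eq_square)
  \<comment> \<open>Cramer's rule\<close>
  then have "u * (a * d - b * c) = 0" "v * (a * d - b * c) = 0"
    by algebra+
  moreover have "a * d - b * c \<noteq> 0"
    using assms(1) unfolding collinear_iff_area_zero a_def b_def c_def d_def
    by (simp add: algebra_simps)
  ultimately show ?thesis
    by (simp add: u_def v_def complex_eq_iff)
qed

section \<open>Second intersections and projection through a point\<close>

lemma second_intersection_eqI:
  assumes "K \<inter> l = {S, S'}"
  shows "second_intersection K l S = S'"
  unfolding second_intersection_def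
  by (rule the_equality) (use assms in \<open>auto simp: doubleton_eq_iff\<close>)

text \<open>Along \<open>S + t (Q - S)\<close> the equation of the sphere is quadratic in \<open>t\<close> with root \<open>0\<close>; the other
  root is given explicitly, and it is \<open>0\<close> again exactly in the tangent case.\<close>

lemma sphere_inter_line:
  fixes S Q c :: "'a::real_inner"
  assumes S: "S \<in> sphere c R" and "Q \<noteq> S"
  obtains S' where "sphere c R \<inter> affine hull {S, Q} = {S, S'}"
proof -
  define v where "v = Q - S"
  define \<tau> where "\<tau> = - 2 * ((S - c) \<bullet> v) / (v \<bullet> v)"
  have v: "v \<bullet> v \<noteq> 0" using assms by (simp add: v_def)
  have R: "R \<ge> 0" "(S - c) \<bullet> (S - c) = R\<^sup>2"
    using S by (auto simp: dist_norm norm_minus_commute power2_norm_eq_inner[symmetric])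
  have on_sphere: "S + t *\<^sub>R v \<in> sphere c R \<longleftrightarrow> t = 0 \<or> t = \<tau>" for t
  proof -
    have "S + t *\<^sub>R v \<in> sphere c R \<longleftrightarrow> (norm ((S - c) + t *\<^sub>R v))\<^sup>2 = R\<^sup>2"
      using R(1) by (simp add: dist_norm norm_minus_commute algebra_simps)
    also have "\<dots> \<longleftrightarrow> t * (2 * ((S - c) \<bullet> v) + t * (v \<bullet> v)) = 0"
      unfolding power2_norm_eq_inner inner_add_left inner_add_right R(2)[symmetric]
      by (simp add: algebra_simps inner_commute)
    also have "\<dots> \<longleftrightarrow> t = 0 \<or> t = \<tau>"
    proof -
      have "2 * ((S - c) \<bullet> v) + t * (v \<bullet> v) = 0 \<longleftrightarrow> t = \<tau>"
        unfolding \<tau>_def nonzero_eq_divide_eq[OF v] by linarith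
      then show ?thesis by simp
    qed
    finally show ?thesis .
  qed
  have line: "affine hull {S, Q} = range (\<lambda>t. S + t *\<^sub>R v)"
    unfolding affine_hull_2_alt v_def by auto
  have "sphere c R \<inter> affine hull {S, Q} = {S, S + \<tau> *\<^sub>R v}"
    unfolding line using on_sphere on_sphere[of 0] on_sphere[of \<tau>] by auto
  then show thesis by (rule that)
qed

lemma not_collinear_on_sphere:
  fixes p q s c :: "'a::euclidean_space"
  assumes on: "p \<in> sphere c R" "q \<in> sphere c R" "s \<in> sphere c R"
    and "p \<noteq> q" "q \<noteq> s" "p \<noteq> s"
  shows "\<not> collinear {p, q, s}"
proof
  assume "collinear {p, q, s}"
  then have "s \<in> affine hull {p, q}"
    using \<open>p \<noteq> q\<close> by (simp add: collinear_3_affine_hull)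
  moreover have "q \<in> affine hull {p, q}" by (simp add: hull_inc)
  moreover obtain S' where "sphere c R \<inter> affine hull {p, q} = {p, S'}"
    using sphere_inter_line on(1) \<open>p \<noteq> q\<close> by metis
  ultimately have "s \<in> {p, S'}" "q \<in> {p, S'}" using on by blast+
  then show False using assms(4-6) by auto
qed

lemma projection_through_line:
  assumes "S \<in> sphere c R" "P \<notin> sphere c R"
  shows "sphere c R \<inter> affine hull {S, P} = {S, projection_through P (sphere c R) S}"
proof -
  obtain S' where S': "sphere c R \<inter> affine hull {S, P} = {S, S'}"
    using sphere_inter_line[of S c R P] assms by metis
  then show ?thesis
    unfolding projection_through_def using second_intersection_eqI[OF S'] by simp
qed

lemma involution_on_projection_through:
  assumes P: "P \<notin> sphere c R"
  shows "involution_on (sphere c R) (projection_through P (sphere c R))"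
  unfolding involution_on_def
proof (intro ballI)
  fix S assume S: "S \<in> sphere c R"
  define S' where "S' = projection_through P (sphere c R) S"
  have chord: "sphere c R \<inter> affine hull {S, P} = {S, S'}"
    unfolding S'_def by (rule projection_through_line[OF S P])
  then have S': "S' \<in> sphere c R" "S' \<in> affine hull {S, P}" by auto
  have "S \<noteq> P" "S' \<noteq> P" using S S'(1) P by auto
  have "collinear {S', P, S}"
    using collinear_3_affine_hull[of S P S'] S'(2) \<open>S \<noteq> P\<close> by (simp add: insert_commute)
  then have "S \<in> affine hull {S', P}"
    using \<open>S' \<noteq> P\<close> by (simp add: collinear_3_affine_hull)
  then have "affine hull {S', P} = affine hull {S, P}"
    using S'(2) by (intro subset_antisym hull_minimal) (auto simp: hull_inc)
  then have "sphere c R \<inter> affine hull {S', P} = {S', S}"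
    using chord by auto
  then have "projection_through P (sphere c R) S' = S"
    unfolding projection_through_def by (rule second_intersection_eqI)
  then show "projection_through P (sphere c R) S \<in> sphere c R \<and>
      projection_through P (sphere c R) (projection_through P (sphere c R) S) = S"
    using S'(1) by (simp add: S'_def)
qed

lemma involution_on_inj_on:
  assumes "involution_on K f"
  shows "inj_on f K"
  using assms unfolding involution_on_def by (metis inj_onI)

section \<open>Indirect similarities\<close>

lemma dist_reflective_affine:
  fixes n m p q :: complex
  shows "dist (n + m * cnj p) (n + m * cnj q) = norm m * dist p q"
proof -
  have "n + m * cnj p - (n + m * cnj q) = m * cnj (p - q)"
    by (simp add: algebra_simps)
  then show ?thesis
    unfolding dist_norm by (simp only: norm_mult complex_mod_cnj)
qed

lemma area_reflective_affine:
  fixes n m p q r :: complex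
  shows "Im (cnj (n + m * cnj q - (n + m * cnj p)) * (n + m * cnj r - (n + m * cnj p))) =
    - (norm m)\<^sup>2 * Im (cnj (q - p) * (r - p))"
proof -
  have "cnj (n + m * cnj q - (n + m * cnj p)) * (n + m * cnj r - (n + m * cnj p)) =
      (m * cnj m) * cnj (cnj (q - p) * (r - p))"
    by (simp add: algebra_simps)
  also have "\<dots> = of_real ((norm m)\<^sup>2) * cnj (cnj (q - p) * (r - p))"
    by (simp only: complex_norm_square)
  finally have eq: "cnj (n + m * cnj q - (n + m * cnj p)) * (n + m * cnj r - (n + m * cnj p)) =
      of_real ((norm m)\<^sup>2) * cnj (cnj (q - p) * (r - p))" .
  show ?thesis
    unfolding eq by (simp add: algebra_simps)
qed

lemma indirect_similarity_reflective_affine: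
  assumes "m \<noteq> 0"
  shows "indirect_similarity (\<lambda>z. n + m * cnj z)"
  unfolding indirect_similarity_def similarity_def orientation_def
    area_reflective_affine dist_reflective_affine
  using assms by (auto simp: sgn_mult intro!: exI[of _ "norm m"])

text \<open>The value at a point \<open>z\<close> has prescribed distances to the images of \<open>A\<close>, \<open>B\<close>, \<open>C\<close>, since the
  ratio of the similarity is the ratio of one side to its image.\<close>

lemma similarity_determined_by_triangle:
  assumes "similarity s" "similarity t"
    and A: "s A = t A" and B: "s B = t B" and C: "s C = t C"
    and image: "\<not> collinear {t A, t B, t C}"
  shows "s = t"
proof
  fix z
  obtain k where k: "\<And>p q. dist (s p) (s q) = k * dist p q"
    using assms(1) unfolding similarity_def by blast
  obtain l where l: "\<And>p q. dist (t p) (t q) = l * dist p q"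
    using assms(2) unfolding similarity_def by blast
  have "A \<noteq> B" using image by auto
  moreover have "k * dist A B = l * dist A B"
    using k[of A B] l[of A B] A B by metis
  ultimately have "k = l" by (metis dist_eq_0_iff mult_right_cancel)
  then have "dist (s z) (t Q) = dist (t z) (t Q)" if "s Q = t Q" for Q
    using k[of z Q] l[of z Q] that by simp
  then show "s z = t z"
    by (intro eq_if_constant_power_difference[OF image]) (simp_all add: A B C)
qed

lemma reflective_affine_image_sphere:
  fixes n m c :: complex
  assumes "m \<noteq> 0"
  shows "(\<lambda>z. n + m * cnj z) ` sphere c R = sphere (n + m * cnj c) (norm m * R)"
proof (intro subset_antisym subsetI)
  fix y assume "y \<in> (\<lambda>z. n + m * cnj z) ` sphere c R"
  then obtain z where "z \<in> sphere c R" "y = n + m * cnj z" by blast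
  then show "y \<in> sphere (n + m * cnj c) (norm m * R)"
    by (simp only: mem_sphere dist_reflective_affine)
next
  fix y assume y: "y \<in> sphere (n + m * cnj c) (norm m * R)"
  have inv: "n + m * cnj (cnj ((y - n) / m)) = y" using assms by simp
  have "norm m * dist c (cnj ((y - n) / m)) = norm m * R"
    using y dist_reflective_affine[of n m c "cnj ((y - n) / m)"] by (simp only: inv mem_sphere)
  then have "cnj ((y - n) / m) \<in> sphere c R" using assms by simp
  then show "y \<in> (\<lambda>z. n + m * cnj z) ` sphere c R"
    using inv by (metis image_eqI)
qed

lemma reflective_affine_image_line:
  fixes n m S Q :: complex
  shows "(\<lambda>z. n + m * cnj z) ` (affine hull {S, Q}) = affine hull {n + m * cnj S, n + m * cnj Q}"
proof -
  have "n + m * cnj (S + u *\<^sub>R (Q - S)) =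
      (n + m * cnj S) + u *\<^sub>R ((n + m * cnj Q) - (n + m * cnj S))" for u
    by (simp add: scaleR_conv_of_real algebra_simps)
  then show ?thesis
    by (simp only: affine_hull_2_alt image_image)
qed

text \<open>Projection through a fixed point \<open>P\<close> commutes with an indirect similarity, because the latter
  maps circles to circles and the lines through \<open>P\<close> to lines through \<open>P\<close>.\<close>

lemma projection_through_reflective_affine:
  fixes n m P c S :: complex
  defines "f \<equiv> \<lambda>z. n + m * cnj z"
  assumes m: "m \<noteq> 0" and P: "f P = P" "P \<notin> sphere c R" and S: "S \<in> sphere c R"
  shows "projection_through P (f ` sphere c R) (f S) = f (projection_through P (sphere c R) S)"
proof -
  have "inj f" using m by (auto simp: f_def inj_on_def)
  then have "f ` sphere c R \<inter> affine hull {f S, P} = f ` (sphere c R \<inter> affine hull {S, P})"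
    using reflective_affine_image_line[of n m S P] P(1)
    by (simp add: f_def image_Int)
  also have "\<dots> = {f S, f (projection_through P (sphere c R) S)}"
    using projection_through_line[OF S P(2)] by simp
  finally show ?thesis
    unfolding projection_through_def[of P "f ` sphere c R"] by (rule second_intersection_eqI)
qed

section \<open>The triangle cut out by the perpendiculars\<close>

text \<open>The second end of the chord is the reflection of \<open>T\<close> in the diameter parallel to \<open>C - B\<close>. In
  coordinates \<open>s = S - \<omega>\<close>, \<open>w = T - \<omega>\<close>, \<open>a = C - B\<close>, orthogonality says that \<open>(s - w) * cnj a\<close> is
  purely imaginary; combined with \<open>s * cnj s = w * cnj w\<close> this factors through \<open>s - w\<close>.\<close>

lemma second_intersection_perpendicular_line:
  assumes T: "T \<in> sphere \<omega> r" and "B \<noteq> C"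
  shows "second_intersection (sphere \<omega> r) (perpendicular_line T B C) T =
    \<omega> + (C - B) / cnj (C - B) * cnj (T - \<omega>)"
proof (rule second_intersection_eqI)
  define a w where "a = C - B" and "w = T - \<omega>"
  have a: "a \<noteq> 0" "cnj a \<noteq> 0" using assms by (auto simp: a_def)
  have r: "norm w = r" using T by (simp add: w_def dist_norm norm_minus_commute)
  have perp: "z \<bullet> a = 0 \<longleftrightarrow> z * cnj a + cnj z * a = 0" for z
    by (auto simp: inner_complex_def complex_eq_iff algebra_simps)
  have "S \<in> sphere \<omega> r \<and> S \<in> perpendicular_line T B C \<longleftrightarrow> S = T \<or> S = \<omega> + a / cnj a * cnj w" for S
  proof -
    define s where "s = S - \<omega>"
    have "S \<in> sphere \<omega> r \<longleftrightarrow> norm s = norm w"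
      by (simp add: r s_def dist_norm norm_minus_commute)
    also have "\<dots> \<longleftrightarrow> s * cnj s = w * cnj w"
      by (metis complex_norm_square norm_ge_zero of_real_eq_iff power2_eq_iff_nonneg)
    finally have sphere: "S \<in> sphere \<omega> r \<longleftrightarrow> s * cnj s = w * cnj w" .
    have line: "S \<in> perpendicular_line T B C \<longleftrightarrow> (s - w) * cnj a + (cnj s - cnj w) * a = 0"
      using perp[of "s - w"] by (simp add: perpendicular_line_def s_def w_def a_def)
    have "s = a / cnj a * cnj w"
      if "s * cnj s = w * cnj w" "(s - w) * cnj a + (cnj s - cnj w) * a = 0" "s \<noteq> w"
    proof -
      have "(cnj s - cnj w) * (s * cnj a - a * cnj w) = 0"
        using that(1,2) by algebra
      moreover have "cnj s - cnj w \<noteq> 0" using that(3) by simp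
      ultimately have "s * cnj a = a * cnj w" by (metis mult_eq_0_iff right_minus_eq)
      then show ?thesis using a by (simp add: field_simps)
    qed
    moreover have "s * cnj s = w * cnj w \<and> (s - w) * cnj a + (cnj s - cnj w) * a = 0"
      if "s = w \<or> s = a / cnj a * cnj w"
      using that
    proof
      assume s: "s = a / cnj a * cnj w"
      show ?thesis unfolding s using a by (simp add: field_simps)
    qed simp
    ultimately have "S \<in> sphere \<omega> r \<and> S \<in> perpendicular_line T B C \<longleftrightarrow>
        s = w \<or> s = a / cnj a * cnj w"
      unfolding sphere line by blast
    moreover have "s = w \<longleftrightarrow> S = T" "s = z \<longleftrightarrow> S = \<omega> + z" for z
      by (auto simp: s_def w_def)
    ultimately show ?thesis by simp
  qed
  then show "sphere \<omega> r \<inter> perpendicular_line T B C =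
      {T, \<omega> + (C - B) / cnj (C - B) * cnj (T - \<omega>)}"
    unfolding a_def[symmetric] w_def[symmetric] by blast
qed

text \<open>With sides \<open>a = C - B\<close>, \<open>b = A - C\<close>, \<open>c = B - A\<close>, the sum \<open>a + b + c\<close> vanishes. Hence
  \<open>b * cnj a - a * cnj b\<close> is unchanged by cyclic shifts; it is \<open>2 * \<i>\<close> times the doubled signed area.
  The factor \<open>m\<close> is read off from
  \<open>b / cnj b - a / cnj a = (b * cnj a - a * cnj b) * cnj c / (cnj a * cnj b * cnj c)\<close>.\<close>

lemma perpendicular_chord_ends_reflective_affine:
  fixes A B C \<omega> w :: complex
  assumes tri: "\<not> collinear {A, B, C}" and "w \<noteq> 0"
  obtains n m where "m \<noteq> 0"
    and "n + m * cnj A = \<omega> + (C - B) / cnj (C - B) * cnj w"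
    and "n + m * cnj B = \<omega> + (A - C) / cnj (A - C) * cnj w"
    and "n + m * cnj C = \<omega> + (B - A) / cnj (B - A) * cnj w"
proof -
  define a b c where "a = C - B" and "b = A - C" and "c = B - A"
  define \<Delta> where "\<Delta> = b * cnj a - a * cnj b"
  define m where "m = cnj w * \<Delta> / (cnj a * cnj b * cnj c)"
  define n where "n = \<omega> + a / cnj a * cnj w - m * cnj A"
  have sides: "cnj a \<noteq> 0" "cnj b \<noteq> 0" "cnj c \<noteq> 0"
    using tri by (auto simp: a_def b_def c_def insert_commute)
  have cyc: "a * cnj c - c * cnj a = \<Delta>"
    by (simp add: a_def b_def c_def \<Delta>_def algebra_simps)
  have "Im \<Delta> = 2 * Im (cnj (B - A) * (C - A))"
    by (simp add: a_def b_def \<Delta>_def algebra_simps)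
  then have "\<Delta> \<noteq> 0"
    using tri unfolding collinear_iff_area_zero by auto
  then have "m \<noteq> 0" using sides \<open>w \<noteq> 0\<close> by (simp add: m_def)
  moreover have "n + m * cnj A = \<omega> + a / cnj a * cnj w" by (simp add: n_def)
  moreover have "n + m * cnj B = \<omega> + b / cnj b * cnj w"
  proof -
    have "m * cnj c = (b / cnj b - a / cnj a) * cnj w"
      using sides unfolding m_def \<Delta>_def by (simp add: field_simps)
    then show ?thesis by (simp add: n_def c_def algebra_simps)
  qed
  moreover have "n + m * cnj C = \<omega> + c / cnj c * cnj w"
  proof -
    have "m * cnj b = (a / cnj a - c / cnj c) * cnj w"
      using sides unfolding m_def cyc[symmetric] by (simp add: field_simps)
    then show ?thesis by (simp add: n_def b_def algebra_simps)
  qed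
  ultimately show thesis
    using that unfolding a_def b_def c_def by blast
qed

theorem theorem8:
  fixes A B C T X Y Z P D E F U V W \<gamma> \<omega> :: complex
    and \<rho> r :: real
    and \<Gamma> \<Omega> :: "complex set"
    and \<sigma> :: "complex \<Rightarrow> complex"
  assumes triangle: "\<not> collinear {A, B, C}"
    and circumcircle: "\<Gamma> = sphere \<gamma> \<rho>" "A \<in> \<Gamma>" "B \<in> \<Gamma>" "C \<in> \<Gamma>"
    and T_off_sides: "T \<notin> affine hull {B, C}" "T \<notin> affine hull {C, A}" "T \<notin> affine hull {A, B}"
    and circle_T: "\<Omega> = sphere \<omega> r" "r > 0" "T \<in> \<Omega>"
    and X: "X = second_intersection \<Omega> (perpendicular_line T B C) T"
    and Y: "Y = second_intersection \<Omega> (perpendicular_line T C A) T"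
    and Z: "Z = second_intersection \<Omega> (perpendicular_line T A B) T"
    and sigma: "\<sigma> = (THE s. indirect_similarity s \<and> s A = X \<and> s B = Y \<and> s C = Z)"
    and centre: "\<sigma> P = P" "\<And>Q. \<sigma> Q = Q \<Longrightarrow> Q = P"
    and P_off: "P \<notin> \<Gamma>"
    and D: "D = second_intersection \<Gamma> (affine hull {A, P}) A"
    and E: "E = second_intersection \<Gamma> (affine hull {B, P}) B"
    and F: "F = second_intersection \<Gamma> (affine hull {C, P}) C"
    and UVW: "U = \<sigma> D" "V = \<sigma> E" "W = \<sigma> F"
  shows "collinear {X, P, U} \<and> collinear {Y, P, V} \<and> collinear {Z, P, W} \<and>
    in_perspective P X Y Z U V W \<and>
    P \<notin> \<Omega> \<and> {X, Y, Z, U, V, W} \<subseteq> \<Omega> \<and>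
    involution_on \<Omega> (projection_through P \<Omega>) \<and>
    projection_through P \<Omega> X = U \<and>
    projection_through P \<Omega> Y = V \<and>
    projection_through P \<Omega> Z = W"
proof -
  have "A \<noteq> B" "B \<noteq> C" "C \<noteq> A"
    using triangle by (auto simp: insert_commute)
  define w where "w = T - \<omega>"
  have "w \<noteq> 0" using circle_T by (auto simp: w_def)
  have "X = \<omega> + (C - B) / cnj (C - B) * cnj w" "Y = \<omega> + (A - C) / cnj (A - C) * cnj w"
    "Z = \<omega> + (B - A) / cnj (B - A) * cnj w"
    unfolding X Y Z circle_T(1) w_def
    using second_intersection_perpendicular_line circle_T(1,3)
      \<open>A \<noteq> B\<close> \<open>B \<noteq> C\<close> \<open>C \<noteq> A\<close> by simp_all
  then obtain n m where m: "m \<noteq> 0"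
    and nm: "n + m * cnj A = X" "n + m * cnj B = Y" "n + m * cnj C = Z"
    using perpendicular_chord_ends_reflective_affine[OF triangle \<open>w \<noteq> 0\<close>, of \<omega>] by metis
  have XYZ: "\<not> collinear {X, Y, Z}"
    using triangle m unfolding nm[symmetric] collinear_iff_area_zero area_reflective_affine by simp
  have \<sigma>: "\<sigma> = (\<lambda>z. n + m * cnj z)"
    unfolding sigma
  proof (rule the_equality)
    show "indirect_similarity (\<lambda>z. n + m * cnj z) \<and>
        n + m * cnj A = X \<and> n + m * cnj B = Y \<and> n + m * cnj C = Z"
      using nm indirect_similarity_reflective_affine[OF m] by simp
  next
    fix s assume "indirect_similarity s \<and> s A = X \<and> s B = Y \<and> s C = Z"
    then show "s = (\<lambda>z. n + m * cnj z)"
      using indirect_similarity_reflective_affine[OF m, of n] nm XYZ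
      by (intro similarity_determined_by_triangle[of s _ A B C])
        (simp_all add: indirect_similarity_def)
  qed
  have \<sigma>ABC: "\<sigma> A = X" "\<sigma> B = Y" "\<sigma> C = Z" using nm by (simp_all add: \<sigma>)

  have XYZ_on: "X \<in> \<Omega>" "Y \<in> \<Omega>" "Z \<in> \<Omega>"
    using \<open>X = _ + _\<close> \<open>Y = _ + _\<close> \<open>Z = _ + _\<close> circle_T \<open>A \<noteq> B\<close> \<open>B \<noteq> C\<close> \<open>C \<noteq> A\<close>
    by (simp_all add: w_def dist_norm norm_mult norm_divide norm_minus_commute
        flip: complex_cnj_diff)
  \<comment> \<open>Both \<open>\<sigma> ` \<Gamma>\<close> and \<open>\<Omega>\<close> are the circumcircle of \<open>XYZ\<close>, so their centres agree.\<close>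
  have image: "\<sigma> ` \<Gamma> = sphere (\<sigma> \<gamma>) (norm m * \<rho>)"
    using reflective_affine_image_sphere[OF m] by (simp add: \<sigma> circumcircle(1))
  have "{X, Y, Z} \<subseteq> \<sigma> ` \<Gamma>" using circumcircle(2-4) \<sigma>ABC by blast
  then have on_image: "dist (\<sigma> \<gamma>) X = norm m * \<rho>" "dist (\<sigma> \<gamma>) Y = norm m * \<rho>"
      "dist (\<sigma> \<gamma>) Z = norm m * \<rho>"
    unfolding image by auto
  have "\<sigma> \<gamma> = \<omega>"
    using XYZ_on on_image unfolding circle_T(1)
    by (intro eq_if_constant_power_difference[OF XYZ]) simp_all
  then have \<Omega>: "\<sigma> ` \<Gamma> = \<Omega>"
    using image on_image(1) XYZ_on(1) unfolding circle_T(1) by simp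
  have "inj \<sigma>" using m by (auto simp: \<sigma> inj_on_def)
  then have P: "P \<notin> \<Omega>"
    using P_off centre(1) unfolding \<Omega>[symmetric] by (metis inj_image_mem_iff)

  have project: "projection_through P \<Omega> (\<sigma> S) = \<sigma> (second_intersection \<Gamma> (affine hull {S, P}) S)"
    if "S \<in> \<Gamma>" for S
    using projection_through_reflective_affine[OF m, of n P \<gamma> \<rho> S] centre(1) P_off that
    unfolding \<Omega>[symmetric] \<sigma> circumcircle(1) projection_through_def[of P "sphere \<gamma> \<rho>"] by simp
  have proj: "projection_through P \<Omega> X = U" "projection_through P \<Omega> Y = V"
      "projection_through P \<Omega> Z = W"
    using project circumcircle(2-4) \<sigma>ABC unfolding UVW D E F by metis+
  have inv: "involution_on \<Omega> (projection_through P \<Omega>)"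
    using involution_on_projection_through P by (simp add: circle_T(1))
  have UVW_on: "U \<in> \<Omega>" "V \<in> \<Omega>" "W \<in> \<Omega>"
    using inv XYZ_on unfolding proj[symmetric] involution_on_def by auto
  have chord: "collinear {S, P, projection_through P \<Omega> S}" if "S \<in> \<Omega>" for S
  proof -
    have "S \<noteq> P" using that P by auto
    moreover have "projection_through P \<Omega> S \<in> affine hull {S, P}"
      using projection_through_line[of S \<omega> r P] that P unfolding circle_T(1) by blast
    ultimately show ?thesis by (simp add: collinear_3_affine_hull)
  qed
  have col: "collinear {X, P, U}" "collinear {Y, P, V}" "collinear {Z, P, W}"
    using chord XYZ_on unfolding proj[symmetric] by auto
  have "X \<noteq> Y" "Y \<noteq> Z" "X \<noteq> Z" using XYZ by (auto simp: insert_commute)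
  then have "U \<noteq> V" "V \<noteq> W" "U \<noteq> W"
    using inj_onD[OF involution_on_inj_on[OF inv]] XYZ_on unfolding proj[symmetric] by metis+
  then have "\<not> collinear {U, V, W}"
    using not_collinear_on_sphere UVW_on unfolding circle_T(1) by metis
  then show ?thesis
    unfolding in_perspective_def using XYZ col P XYZ_on UVW_on inv proj by simp
qed

end
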